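(* Let $X$ be a separable $F$-space, let $a<b$ be real numbers, let $\mathfrak m$ be a Borel measure with $0<\mathfrak m([a,b])<+\infty$, let $(T_\lambda)_{\lambda\in[a,b]}$ be a family of operators on $X$ such that $\lambda\mapsto T_\lambda u$ is continuous for all $u\in X$, and let $\psi\in\Psi$. Assume that, for all $u\in X$, there are a non-empty open set $V\subset X$ and $c>0$ such that $$\forall\, n\gg1,\quad \mathfrak m(\{\lambda\in[a,b]: n\in N_\lambda(u,V)\})\le\frac{c}{\psi(n)} .$$ Then $(T_\lambda)_{\lambda\in[a,b]}$ has no common frequently hypercyclic vector.
   Context: An operator on $X$ is a continuous linear map $X\to X$. $N_\lambda(u,V)=\{n\in\mathbb N_0: T_\lambda^nu\in V\}$. "$\forall n\gg1$" means for all $n\ge n_0$ for some $n_0\in\mathbb N$. For $A\subset\mathbb N_0$, $\underline d(A)=\liminf_{n\to\infty}\frac{\#(A\cap[0,n])}{n+1}$. A vector $u\in X$ is frequently hypercyclic for $T$ if $\underline d(\{k\in\mathbb N_0:T^ku\in U\})>0$ for every non-empty open $U\subset X$; a common frequently hypercyclic vector for $(T_\lambda)$ is one that is frequently hypercyclic for every $T_\lambda$. $\Psi$ is the family of all non-decreasing functions $\psi:(0,+\infty)\to(0,+\infty)$ for which there exists $\eta>0$ such that: (I) for any $t>0$, the sequence $\big(\frac{\psi(n)}{\psi(tn)}\big)_{n\ge1}$ is bounded; (II) $\lim_{n\to+\infty}\psi(n)=+\infty$; (III) there is $t_0>0$ such that $\psi\in\mathcal C^1(t_0,+\infty)$ and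 $\frac{\psi(t)}{\psi'(t)}\ge(1+\eta)t$ for all $t>t_0$ (that is, $(1+\eta)t\,\psi'(t)\le\psi(t)$). *)

theory Defs
  imports "HOL-Analysis.Analysis"
begin

text \<open>
  The scalar field is any \<^class>\<open>real_normed_field\<close>; by the Gelfand--Mazur theorem this
  means exactly the real or the complex numbers. The complete metric is the one of the
  type class; continuity of addition follows from its translation invariance.
\<close>

locale F_space = vector_space smul
  for smul :: "'k::real_normed_field \<Rightarrow> 'a::{ab_group_add, complete_space} \<Rightarrow> 'a" +
  assumes dist_translation: "dist (x + z) (y + z) = dist x (y::'a)"
    and continuous_scale: "continuous_on UNIV (\<lambda>(r, x). smul r x)"

definition continuous_operator ::
  "('k::field \<Rightarrow> 'a::{ab_group_add, topological_space} \<Rightarrow> 'a) \<Rightarrow> ('a \<Rightarrow> 'a) \<Rightarrow> bool" where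
  "continuous_operator smul T \<longleftrightarrow> Vector_Spaces.linear smul smul T \<and> continuous_on UNIV T"

definition visit_times :: "('a \<Rightarrow> 'a) \<Rightarrow> 'a \<Rightarrow> 'a set \<Rightarrow> nat set" where
  "visit_times T u V = {n. (T ^^ n) u \<in> V}"

definition lower_density :: "nat set \<Rightarrow> ereal" where
  "lower_density A = liminf (\<lambda>n. ereal (real (card (A \<inter> {0..n})) / (real n + 1)))"

definition frequently_hypercyclic :: "('a::topological_space \<Rightarrow> 'a) \<Rightarrow> 'a \<Rightarrow> bool" where
  "frequently_hypercyclic T u \<longleftrightarrow>
     (\<forall>U. open U \<and> U \<noteq> {} \<longrightarrow> lower_density (visit_times T u U) > 0)"

definition common_frequently_hypercyclic ::
  "(real \<Rightarrow> 'a::topological_space \<Rightarrow> 'a) \<Rightarrow> real set \<Rightarrow> 'a \<Rightarrow> bool" where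
  "common_frequently_hypercyclic T I u \<longleftrightarrow> (\<forall>l\<in>I. frequently_hypercyclic (T l) u)"

text \<open>
  Functions on the open half-line are total functions whose values outside it are ignored.
  The inequality \<open>\<psi> t / \<psi>' t \<ge> (1 + \<eta>) t\<close> is stated without division, so that it holds
  where the derivative vanishes (quotient \<open>+\<infinity>\<close>).
\<close>

definition Psi_class :: "(real \<Rightarrow> real) set" where
  "Psi_class = {\<psi>.
     (\<forall>t>0. \<psi> t > 0) \<and> mono_on {0<..} \<psi> \<and>
     (\<exists>\<eta>>0.
        (\<forall>t>0. bounded ((\<lambda>n::nat. \<psi> (real n) / \<psi> (t * real n)) ` {1..})) \<and>
        filterlim (\<lambda>n::nat. \<psi> (real n)) at_top sequentially \<and>
        (\<exists>t0>0. \<psi> C1_differentiable_on {t0<..} \<and>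
           (\<forall>t>t0. (1 + \<eta>) * t * deriv \<psi> t \<le> \<psi> t)))}"

end

theory Submission
  imports Defs
begin

text \<open>
  Fix a vector \<open>u\<close> with its open set \<open>V\<close>, and let \<open>A n\<close> be the set of parameters \<open>l\<close> whose orbit
  of \<open>u\<close> is in \<open>V\<close> at time \<open>n\<close>. Since \<open>\<psi>\<close> tends to infinity, the measures of the \<open>A n\<close> tend to
  \<open>0\<close>, hence so do their Cesaro means. The mean of the first \<open>N + 1\<close> of these measures is the
  integral over \<open>l\<close> of the proportion of times up to \<open>N\<close> at which the orbit is in \<open>V\<close>, so Fatou's
  lemma makes the lower limit of these proportions, which is the lower density of the visit times,
  vanish for almost every \<open>l\<close> (\<open>AE_lower_density_eq_0\<close>). As the interval has positive measure, such an
  \<open>l\<close> exists, and \<open>u\<close> is not frequently hypercyclic for its operator.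

  The argument needs the sets \<open>A n\<close> to be measurable. The map \<open>(l, x) \<mapsto> T l x\<close> is a Caratheodory
  function: it is measurable (even continuous) in the parameter \<open>l\<close> and continuous in \<open>x\<close>. Over a
  separable metric space such a function turns a measurable choice of points \<open>l \<mapsto> g l\<close> into
  the measurable map \<open>l \<mapsto> T l (g l)\<close> (\<open>borel_measurable_Caratheodory\<close>), and the iterates
  \<open>l \<mapsto> (T l ^^ n) u\<close> follow by induction on \<open>n\<close>.
\<close>

text \<open>
  The map \<open>g\<close> is a pointwise limit of maps taking their values in a countable dense set: at
  precision \<open>1 / Suc i\<close>, take the first dense point within that distance of \<open>g l\<close>. Along each of these,
  measurability can be checked on countably many pieces, on which the second argument of \<open>f\<close> is
  constant; continuity of \<open>f l\<close> then lets it pass to the limit.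
\<close>

lemma borel_measurable_Caratheodory:
  fixes f :: "'l \<Rightarrow> 'a::metric_space \<Rightarrow> 'b::metric_space" and g :: "'l \<Rightarrow> 'a"
  assumes separable: "separable_space (euclidean :: 'a topology)"
    and measurable: "\<And>x. (\<lambda>l. f l x) \<in> borel_measurable M"
    and cont: "\<And>l. l \<in> space M \<Longrightarrow> continuous_on UNIV (f l)"
    and g: "g \<in> borel_measurable M"
  shows "(\<lambda>l. f l (g l)) \<in> borel_measurable M"
proof -
  obtain C :: "'a set" where C: "countable C" "closure C = UNIV"
    using separable by (auto simp: separable_space_def)
  then have "C \<noteq> {}"
    by auto
  define d where "d = from_nat_into C"
  have dense: "\<exists>k. dist (d k) x < e" if e: "e > 0" for x e
  proof -
    have "x \<in> closure C"
      using C by simp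
    then obtain y where "y \<in> C" "dist y x < e"
      using e unfolding closure_approachable by blast
    then show ?thesis
      using from_nat_into_surj[OF C(1)] by (auto simp: d_def)
  qed
  define h where "h i l = (LEAST k. dist (d k) (g l) < inverse (real (Suc i)))" for i l
  have h_close: "dist (d (h i l)) (g l) < inverse (real (Suc i))" for i l
    unfolding h_def by (rule LeastI_ex) (rule dense, simp)
  have dist_meas [measurable]: "(\<lambda>l. dist (d k) (g l)) \<in> borel_measurable M" for k
    by (rule measurable_compose[OF g], rule borel_measurable_continuous_onI)
       (intro continuous_intros)
  have h_meas: "h i \<in> measurable M (count_space UNIV)" for i
    unfolding h_def by measurable
  have "(\<lambda>l. f l (d (h i l))) \<in> borel_measurable M" for i
    using measurable_compose_countable[OF measurable h_meas] .
  moreover have "(\<lambda>i. f l (d (h i l))) \<longlonglongrightarrow> f l (g l)" if "l \<in> space M" for l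
  proof -
    have "(\<lambda>i. dist (d (h i l)) (g l)) \<longlonglongrightarrow> 0"
    proof (rule tendsto_sandwich[OF _ _ tendsto_const LIMSEQ_inverse_real_of_nat])
      show "\<forall>\<^sub>F i in sequentially. dist (d (h i l)) (g l) \<le> inverse (real (Suc i))"
        by (rule always_eventually, rule allI, rule less_imp_le, rule h_close)
    qed simp
    then have "(\<lambda>i. d (h i l)) \<longlonglongrightarrow> g l"
      by (rule tendsto_dist_iff[THEN iffD2])
    then show ?thesis
      by (rule continuous_on_tendsto_compose[OF cont[OF that]]) simp_all
  qed
  ultimately show ?thesis
    by (rule borel_measurable_LIMSEQ_metric)
qed

lemma borel_measurable_funpow:
  fixes T :: "'l \<Rightarrow> 'a::metric_space \<Rightarrow> 'a"
  assumes "separable_space (euclidean :: 'a topology)"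
    and "\<And>x. (\<lambda>l. T l x) \<in> borel_measurable M"
    and "\<And>l. l \<in> space M \<Longrightarrow> continuous_on UNIV (T l)"
  shows "(\<lambda>l. (T l ^^ n) u) \<in> borel_measurable M"
  by (induction n) (auto intro: borel_measurable_Caratheodory[OF assms])

lemma Cesaro_means_tendsto_0:
  fixes p :: "nat \<Rightarrow> real"
  assumes "p \<longlonglongrightarrow> 0"
  shows "(\<lambda>n. (\<Sum>k\<in>{0..n}. p k) / (real n + 1)) \<longlonglongrightarrow> 0"
proof (rule LIMSEQ_I)
  fix e :: real
  assume "e > 0"
  then obtain K where K: "\<And>k. k \<ge> K \<Longrightarrow> \<bar>p k\<bar> < e / 2"
    using LIMSEQ_D[OF assms, of "e / 2"] by auto
  define S where "S = (\<Sum>k<K. \<bar>p k\<bar>)"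
  obtain N where N: "2 * S / e < real N"
    using reals_Archimedean2 by blast
  have "norm ((\<Sum>k\<in>{0..n}. p k) / (real n + 1) - 0) < e" if "n \<ge> N" for n
  proof -
    \<comment> \<open>The finitely many terms before \<open>K\<close> add at most \<open>S\<close>, which \<open>n + 1\<close> outgrows.\<close>
    have "\<bar>\<Sum>k\<in>{0..n}. p k\<bar> \<le> (\<Sum>k\<in>{0..n}. (if k < K then \<bar>p k\<bar> else 0) + e / 2)"
      using K \<open>e > 0\<close> by (intro order.trans[OF sum_abs] sum_mono) (auto simp: not_less intro: less_imp_le)
    also have "\<dots> = (\<Sum>k\<in>{0..n} \<inter> {..<K}. \<bar>p k\<bar>) + (real n + 1) * (e / 2)"
      by (simp add: sum.distrib sum.inter_restrict lessThan_def)
    also have "\<dots> \<le> S + (real n + 1) * (e / 2)"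
      unfolding S_def by (intro add_right_mono sum_mono2) auto
    also have "S < (real n + 1) * (e / 2)"
    proof -
      have "2 * S / e < real n + 1"
        using N that by linarith
      then show ?thesis
        using \<open>e > 0\<close> by (simp add: field_simps)
    qed
    finally show ?thesis
      by (simp add: field_simps)
  qed
  then show "\<exists>N. \<forall>n\<ge>N. norm ((\<Sum>k\<in>{0..n}. p k) / (real n + 1) - 0) < e"
    by blast
qed

text \<open>
  Positive lower density says that the proportions of the times \<open>n\<close> with \<open>x \<in> A n\<close> have a positive
  lower limit at \<open>x\<close>. By Fatou's lemma the integral of that lower limit is at most the lower limit of
  the Cesaro means of the measures of the \<open>A n\<close>, which is \<open>0\<close>.
\<close>

lemma (in finite_measure) AE_lower_density_eq_0:
  assumes A [measurable]: "\<And>n. A n \<in> sets M"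
    and null: "(\<lambda>n. measure M (A n)) \<longlonglongrightarrow> 0"
  shows "AE x in M. \<not> lower_density {n. x \<in> A n} > 0"
proof -
  define r where "r n x = (\<Sum>k\<in>{0..n}. indicator (A k) x) / (real n + 1)" for n x
  have r_card: "r n x = real (card ({k. x \<in> A k} \<inter> {0..n})) / (real n + 1)" for n x
    by (simp add: r_def indicator_def sum.If_cases Int_commute)
  have r_meas [measurable]: "r n \<in> borel_measurable M" for n
    unfolding r_def by measurable
  have "(\<integral>\<^sup>+x. ennreal (r n x) \<partial>M) = ennreal ((\<Sum>k\<in>{0..n}. measure M (A k)) / (real n + 1))" for n
  proof -
    have int: "integrable M (indicator (A k) :: 'a \<Rightarrow> real)" for k
      by (simp add: less_top[symmetric])
    then have "integrable M (r n)"
      unfolding r_def by auto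
    moreover have "integral\<^sup>L M (r n) = (\<Sum>k\<in>{0..n}. measure M (A k)) / (real n + 1)"
      unfolding r_def using int by simp
    ultimately show ?thesis
      by (subst nn_integral_eq_integral) (auto simp: r_card)
  qed
  moreover have "(\<lambda>n. ennreal ((\<Sum>k\<in>{0..n}. measure M (A k)) / (real n + 1))) \<longlonglongrightarrow> ennreal 0"
    by (intro tendsto_ennrealI Cesaro_means_tendsto_0 null)
  ultimately have "liminf (\<lambda>n. \<integral>\<^sup>+x. ennreal (r n x) \<partial>M) = 0"
    by (simp add: lim_imp_Liminf)
  moreover have "(\<integral>\<^sup>+x. liminf (\<lambda>n. ennreal (r n x)) \<partial>M) \<le> liminf (\<lambda>n. \<integral>\<^sup>+x. ennreal (r n x) \<partial>M)"
    by (rule nn_integral_liminf) measurable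
  ultimately have "(\<integral>\<^sup>+x. liminf (\<lambda>n. ennreal (r n x)) \<partial>M) = 0"
    by simp
  then have "AE x in M. liminf (\<lambda>n. ennreal (r n x)) = 0"
    by (subst (asm) nn_integral_0_iff_AE) measurable
  then show ?thesis
  proof (rule AE_mp, intro AE_I2 impI notI)
    fix x
    assume zero: "liminf (\<lambda>n. ennreal (r n x)) = 0"
      and "lower_density {n. x \<in> A n} > 0"
    then have "0 < liminf (\<lambda>n. ereal (r n x))"
      by (simp add: lower_density_def r_card)
    then obtain c where c: "0 < ereal c" "ereal c < liminf (\<lambda>n. ereal (r n x))"
      using ereal_dense2 by blast
    from less_LiminfD[OF c(2)] have "\<forall>\<^sub>F n in sequentially. ennreal c \<le> ennreal (r n x)"
      by eventually_elim (auto intro: ennreal_leI)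
    then have "ennreal c \<le> liminf (\<lambda>n. ennreal (r n x))"
      by (rule Liminf_bounded)
    with zero c(1) show False
      by simp
  qed
qed

theorem theorem3p22:
  fixes smul :: "'k::real_normed_field \<Rightarrow> 'a::{ab_group_add, complete_space} \<Rightarrow> 'a"
    and T :: "real \<Rightarrow> 'a \<Rightarrow> 'a"
    and \<mu> :: "real measure"
    and a b :: real
    and \<psi> :: "real \<Rightarrow> real"
  assumes "F_space smul"
    and "separable_space (euclidean :: 'a topology)"
    and "a < b"
    and "sets \<mu> = sets borel"
    and "0 < emeasure \<mu> {a..b}" and "emeasure \<mu> {a..b} < \<infinity>"
    and "\<And>l. l \<in> {a..b} \<Longrightarrow> continuous_operator smul (T l)"
    and "\<And>u. continuous_on {a..b} (\<lambda>l. T l u)"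
    and "\<psi> \<in> Psi_class"
    and "\<And>u. \<exists>V c. open V \<and> V \<noteq> {} \<and> c > 0 \<and>
           (\<forall>\<^sub>F n in sequentially.
              emeasure \<mu> {l\<in>{a..b}. n \<in> visit_times (T l) u V} \<le> ennreal (c / \<psi> (real n)))"
  shows "\<not> (\<exists>u. common_frequently_hypercyclic T {a..b} u)"
proof
  assume "\<exists>u. common_frequently_hypercyclic T {a..b} u"
  then obtain u where u: "\<And>l. l \<in> {a..b} \<Longrightarrow> frequently_hypercyclic (T l) u"
    unfolding common_frequently_hypercyclic_def by blast
  obtain V c where V: "open V" "V \<noteq> {}" and "c > 0"
    and small: "\<forall>\<^sub>F n in sequentially.
      emeasure \<mu> {l\<in>{a..b}. n \<in> visit_times (T l) u V} \<le> ennreal (c / \<psi> (real n))"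
    using assms(10)[of u] by blast
  have \<psi>_top: "filterlim (\<lambda>n. \<psi> (real n)) at_top sequentially"
    using assms(9) by (auto simp: Psi_class_def)
  \<comment> \<open>Continuity of the operators is only given for parameters in the interval.\<close>
  define M where "M = restrict_space \<mu> {a..b}"
  have interval: "{a..b} \<inter> space \<mu> \<in> sets \<mu>"
    using assms(4) by auto
  have space_M: "space M = {a..b}"
    using sets_eq_imp_space_eq[OF assms(4)] by (simp add: M_def space_restrict_space)
  have emeasure_M: "emeasure M B = emeasure \<mu> B" if "B \<subseteq> {a..b}" for B
    unfolding M_def using interval that by (rule emeasure_restrict_space)
  interpret M: finite_measure M
    by (rule finite_measureI) (use assms(6) in \<open>simp add: space_M emeasure_M\<close>)
  define A where "A n = {l \<in> {a..b}. n \<in> visit_times (T l) u V}" for n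
  have T_meas: "(\<lambda>l. T l x) \<in> borel_measurable M" for x
  proof -
    have "(\<lambda>l. T l x) \<in> borel_measurable (restrict_space borel {a..b})"
      by (rule borel_measurable_continuous_on_restrict) (rule assms(8))
    moreover have "sets M = sets (restrict_space borel {a..b})"
      unfolding M_def by (rule sets_restrict_space_cong) (rule assms(4))
    ultimately show ?thesis
      by (simp cong: measurable_cong_sets)
  qed
  have A_meas: "A n \<in> sets M" for n
  proof -
    have "(\<lambda>l. (T l ^^ n) u) \<in> borel_measurable M"
      using assms(7) by (intro borel_measurable_funpow[OF assms(2) T_meas])
        (auto simp: space_M continuous_operator_def)
    from measurable_sets[OF this, of V] show ?thesis
      using V by (simp add: A_def visit_times_def space_M vimage_def Int_def conj_commute)
  qed
  have "(\<lambda>n. measure M (A n)) \<longlonglongrightarrow> 0"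
  proof (rule tendsto_sandwich[OF _ _ tendsto_const])
    show "(\<lambda>n. c / \<psi> (real n)) \<longlonglongrightarrow> 0"
      by (rule tendsto_divide_0[OF tendsto_const])
         (rule filterlim_mono[OF \<psi>_top at_top_le_at_infinity order_refl])
    have "\<forall>\<^sub>F n in sequentially. 0 < \<psi> (real n)"
      using \<psi>_top by (simp add: filterlim_at_top_dense)
    with small show "\<forall>\<^sub>F n in sequentially. measure M (A n) \<le> c / \<psi> (real n)"
    proof eventually_elim
      case (elim n)
      then have "ennreal (measure M (A n)) \<le> ennreal (c / \<psi> (real n))"
        by (subst M.emeasure_eq_measure[symmetric], subst emeasure_M) (auto simp: A_def)
      with elim \<open>c > 0\<close> show ?case
        by (simp add: ennreal_le_iff)
    qed
  qed simp
  with A_meas have "AE l in M. \<not> lower_density {n. l \<in> A n} > 0"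
    by (rule M.AE_lower_density_eq_0)
  moreover have "lower_density {n. l \<in> A n} > 0" if "l \<in> space M" for l
    using u[of l] V that by (simp add: frequently_hypercyclic_def A_def space_M)
  ultimately have "AE l in M. False"
    by (auto intro: AE_mp[OF _ AE_I2])
  then have "emeasure M (space M) = 0"
    by (simp add: AE_iff_measurable[OF sets.top])
  with assms(5) show False
    by (simp add: space_M emeasure_M)
qed

end
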